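(* Let $q$ be a prime power and let $m,r,w\ge1$ be integers with $\gcd(m,r)=1$. Let $\gamma_1,\dots,\gamma_w\in\overline{\mathbb F}_q$ be linearly independent over $\mathbb F_q$, and suppose $\vec b=(b_1,\dots,b_w)\in\mathbb F_{q^m}^{\,w}$ satisfies $$\sum_{k=1}^wb_k\gamma_k^{[ri]}=0\qquad\text{for } 0\le i\le w-1.$$ Then $\vec b=0$.
   Context: $\overline{\mathbb F}_q$ is an algebraic closure of $\mathbb F_q$ containing $\mathbb F_{q^m}$. For an integer $i\ge0$, $[i]=q^i$, so $\gamma^{[ri]}=\gamma^{q^{ri}}$. *)

theory Defs
  imports "HOL-Algebra.Algebraic_Closure" "HOL-Number_Theory.Prime_Powers"
begin

end

theory Submission
  imports Defs
begin

text \<open>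
  Let \<open>h\<close> be the map \<open>x \<mapsto> x [^] (q ^ r)\<close>, a ring endomorphism of \<open>L\<close>. The relations say that the
  vector \<open>b\<close> over \<open>K\<close> annihilates \<open>h\<^sup>i \<gamma>\<close> for all \<open>i < w\<close>. The idea is that every such relation
  forces one more nonzero entry: a nonzero vector over \<open>K\<close> annihilating
  \<open>h\<^sup>i \<gamma>\<close> for all \<open>i < n\<close> has more than \<open>n\<close> nonzero entries. For \<open>n = w\<close> this leaves only
  \<open>b = 0\<close>.

  The claim is proved by induction on \<open>n\<close> in \<open>endomorphism_relations_imp_zero\<close>. Suppose that
  a nonzero \<open>a\<close> satisfies \<open>n + 1\<close> relations and has at most \<open>n + 1\<close> nonzero entries, one of
  them scaled to be \<open>1\<close>. Since \<open>K\<close> is finite, \<open>h\<close> permutes it, so \<open>a = h c\<close> entrywise for some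
  \<open>c\<close> over \<open>K\<close>. Undoing \<open>h\<close> turns the relations \<open>1, \<dots>, n\<close> of \<open>a\<close> into the relations
  \<open>0, \<dots>, n - 1\<close> of \<open>c\<close>; hence \<open>c - a\<close> satisfies \<open>n\<close> relations, and it has at most \<open>n\<close>
  nonzero entries because the entry \<open>1\<close> cancels. By induction \<open>c = a\<close>, that is, \<open>h\<close> fixes
  every entry of \<open>a\<close>.

  Here the coprimality of \<open>m\<close> and \<open>r\<close> enters: an element of \<open>K\<close> is fixed by raising to the
  power \<open>q ^ m\<close>, so if it is also fixed by \<open>h\<close>, it is fixed by raising to the power \<open>q\<close>
  (\<open>pow_power_fixed_coprime\<close>) and therefore lies in \<open>F\<close>
  (\<open>mem_finite_subfield_if_pow_card\<close>). Thus \<open>a\<close> is a nonzero vector over \<open>F\<close> with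
  \<open>\<Sum>k. a k * \<gamma> k = 0\<close>, against the independence of the \<open>\<gamma> k\<close>.
\<close>

section \<open>The Frobenius endomorphism\<close>

lemma (in cring) binomial_cring:
  assumes x: "x \<in> carrier R" and y: "y \<in> carrier R"
  shows "(x \<oplus> y) [^] (n::nat) =
    (\<Oplus>k\<in>{..n}. [(n choose k)] \<cdot> (x [^] k \<otimes> y [^] (n - k)))"
proof (induction n)
  case 0
  show ?case using x y by (simp add: add.nat_pow_eone)
next
  case (Suc n)
  define t where "t k = x [^] k \<otimes> y [^] (Suc n - k)" for k
  \<comment> \<open>the \<open>k\<close>-th summand that comes from multiplying by \<open>x\<close>, padded by zero at \<open>k = 0\<close>
     so that both products are sums over the same index set and Pascal's rule applies termwise\<close>
  define left where "left k = (case k of 0 \<Rightarrow> \<zero> | Suc i \<Rightarrow> [(n choose i)] \<cdot> t k)" for k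
  have t [simp]: "t k \<in> carrier R" for k
    using x y by (simp add: t_def)
  have left [simp]: "left k \<in> carrier R" for k
    by (simp add: left_def split: nat.split)
  have times_x: "[c] \<cdot> (x [^] k \<otimes> y [^] (n - k)) \<otimes> x = [c] \<cdot> t (Suc k)" for c k :: nat
    using x y by (subst add_pow_ldistr) (auto simp: t_def m_ac)
  have times_y: "[(n choose k)] \<cdot> (x [^] k \<otimes> y [^] (n - k)) \<otimes> y = [(n choose k)] \<cdot> t k"
    if "k \<le> n" for k
    using x y that by (simp add: t_def add_pow_ldistr m_assoc Suc_diff_le)
  have sum_x: "(\<Oplus>k\<in>{..n}. [(n choose k)] \<cdot> (x [^] k \<otimes> y [^] (n - k))) \<otimes> x
      = (\<Oplus>k\<in>{..Suc n}. left k)"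
  proof -
    have "(\<Oplus>k\<in>{..n}. [(n choose k)] \<cdot> (x [^] k \<otimes> y [^] (n - k))) \<otimes> x
        = (\<Oplus>k\<in>{..n}. [(n choose k)] \<cdot> t (Suc k))"
      using x y by (subst finsum_ldistr) (simp_all add: Pi_def times_x)
    also have "\<dots> = (\<Oplus>k\<in>{..n}. left (Suc k)) \<oplus> left 0"
      by (simp add: left_def)
    also have "\<dots> = (\<Oplus>k\<in>{..Suc n}. left k)"
      by (rule finsum_Suc2 [symmetric]) simp
    finally show ?thesis .
  qed
  have sum_y: "(\<Oplus>k\<in>{..n}. [(n choose k)] \<cdot> (x [^] k \<otimes> y [^] (n - k))) \<otimes> y
      = (\<Oplus>k\<in>{..Suc n}. [(n choose k)] \<cdot> t k)"
  proof -
    have "(\<Oplus>k\<in>{..n}. [(n choose k)] \<cdot> (x [^] k \<otimes> y [^] (n - k))) \<otimes> y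
        = (\<Oplus>k\<in>{..n}. [(n choose k)] \<cdot> t k)"
      using x y by (subst finsum_ldistr) (auto simp: times_y intro!: finsum_cong')
    also have "\<dots> = (\<Oplus>k\<in>{..Suc n}. [(n choose k)] \<cdot> t k)"
      by (subst finsum_Suc) (simp_all add: binomial_eq_0)
    finally show ?thesis .
  qed
  have "(x \<oplus> y) [^] Suc n = (\<Oplus>k\<in>{..Suc n}. left k) \<oplus> (\<Oplus>k\<in>{..Suc n}. [(n choose k)] \<cdot> t k)"
    using x y by (simp add: Suc.IH r_distr flip: sum_x sum_y)
  also have "\<dots> = (\<Oplus>k\<in>{..Suc n}. left k \<oplus> [(n choose k)] \<cdot> t k)"
    by (simp add: finsum_addf Pi_def)
  also have "\<dots> = (\<Oplus>k\<in>{..Suc n}. [(Suc n choose k)] \<cdot> t k)"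
    by (rule finsum_cong')
       (auto simp: left_def add.nat_pow_mult add.m_comm split: nat.split)
  finally show ?case by (simp only: t_def)
qed

text \<open>
  In the binomial expansion, \<open>p\<close> divides every coefficient except the two outer ones.
\<close>

lemma (in cring) prime_char_pow_add:
  fixes p :: nat
  assumes p: "prime p" and char: "[p] \<cdot> \<one> = \<zero>"
    and x: "x \<in> carrier R" and y: "y \<in> carrier R"
  shows "(x \<oplus> y) [^] p = x [^] p \<oplus> y [^] p"
proof -
  have multiple_zero: "[n] \<cdot> z = \<zero>" if "p dvd n" "z \<in> carrier R" for n z
  proof -
    from that obtain c where n: "n = p * c" by blast
    have "[p] \<cdot> z = ([p] \<cdot> \<one>) \<otimes> z"
      using that by (simp add: add_pow_ldistr)
    then have "[p] \<cdot> z = \<zero>" using that char by simp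
    then have "[c] \<cdot> ([p] \<cdot> z) = \<zero>" by simp
    then show ?thesis using that n by (simp add: add.nat_pow_pow)
  qed
  \<comment> \<open>writing \<open>p = d + 2\<close> lets both outer summands be split off, leaving the indices
     \<open>1, \<dots>, d + 1\<close>\<close>
  obtain d where d: "p = Suc (Suc d)"
    using prime_ge_2_nat[OF p] by (metis add_2_eq_Suc le_Suc_ex)
  define s where "s k = [(p choose k)] \<cdot> (x [^] k \<otimes> y [^] (p - k))" for k
  have s [simp]: "s k \<in> carrier R" for k using x y by (simp add: s_def)
  have middle: "s (Suc k) = \<zero>" if "k \<le> d" for k
  proof -
    have "p dvd p choose Suc k"
      using p that by (intro dvd_choose_prime) (auto simp: d)
    then show ?thesis unfolding s_def using x y by (intro multiple_zero) auto
  qed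
  have "(x \<oplus> y) [^] p = (\<Oplus>k\<in>{..Suc (Suc d)}. s k)"
    unfolding s_def using binomial_cring[OF x y, of p] d by simp
  also have "\<dots> = s (Suc (Suc d)) \<oplus> ((\<Oplus>k\<in>{..d}. s (Suc k)) \<oplus> s 0)"
    by (subst finsum_Suc, simp, subst finsum_Suc2) simp_all
  also have "(\<Oplus>k\<in>{..d}. s (Suc k)) = \<zero>"
    using middle by (intro add.finprod_one_eqI) auto
  finally show ?thesis
    using x y by (simp add: s_def d)
qed

lemma (in cring) frobenius_ring_hom:
  fixes p :: nat
  assumes p: "prime p" and char: "[p] \<cdot> \<one> = \<zero>"
  shows "(\<lambda>x. x [^] (p ^ n)) \<in> ring_hom R R"
proof -
  have add: "(x \<oplus> y) [^] (p ^ n) = x [^] (p ^ n) \<oplus> y [^] (p ^ n)"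
    if "x \<in> carrier R" "y \<in> carrier R" for x y
  proof (induction n)
    case (Suc n)
    have pow: "z [^] (p ^ Suc n) = (z [^] (p ^ n)) [^] p" if "z \<in> carrier R" for z
      using that by (simp add: nat_pow_pow mult.commute)
    show ?case
      using that prime_char_pow_add[OF p char] by (simp only: pow Suc.IH a_closed nat_pow_closed)
  qed (use that in simp)
  show ?thesis
    by (rule ring_hom_memI) (auto simp: add nat_pow_distrib)
qed

section \<open>Finite subfields\<close>

text \<open>
  Lagrange's theorem in the multiplicative group of \<open>F\<close>; the extra factor \<open>x\<close> covers \<open>\<zero>\<close>.
\<close>

lemma (in field) finite_subfield_pow_card:
  assumes F: "subfield F R" and fin: "finite F" and x: "x \<in> F"
  shows "x [^] card F = x"
proof -
  have F0: "\<zero> \<in> F" and FR: "F \<subseteq> carrier R"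
    using subringE[OF subfieldE(1)[OF F]] by auto
  have card: "card F = Suc (card (F - {\<zero>}))"
    using F0 fin by (metis card_Suc_Diff1)
  show ?thesis
  proof (cases "x = \<zero>")
    case True
    then show ?thesis using card by simp
  next
    case False
    have "x [^]\<^bsub>Multiplicative_Group.mult_of R\<lparr>carrier := F - {\<zero>}\<rparr>\<^esub> order (Multiplicative_Group.mult_of R\<lparr>carrier := F - {\<zero>}\<rparr>)
        = \<one>\<^bsub>Multiplicative_Group.mult_of R\<lparr>carrier := F - {\<zero>}\<rparr>\<^esub>"
      using False x
      by (intro group.pow_order_eq_1 group.subgroup_imp_group field_mult_group subgroup_mult_of F) auto
    then have "x [^] card (F - {\<zero>}) = \<one>"
      by (simp add: order_def nat_pow_def Multiplicative_Group.mult_of_def)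
    then show ?thesis
      using card x FR by auto
  qed
qed

text \<open>
  Lagrange's theorem in the additive group of \<open>F\<close> kills \<open>[(p ^ e)] \<cdot> \<one>\<close>, which is the
  \<open>e\<close>-th power of \<open>[p] \<cdot> \<one>\<close>; a field has no nilpotent elements besides \<open>\<zero>\<close>.
\<close>

lemma (in field) finite_subfield_char:
  fixes p :: nat
  assumes F: "subfield F R" and p: "prime p" and card: "card F = p ^ e"
  shows "[p] \<cdot> \<one> = \<zero>"
proof -
  have sub: "subgroup F (add_monoid R)"
    using subring.axioms(1)[OF subfieldE(1)[OF F]] .
  have one: "\<one> \<in> F" using subringE(3)[OF subfieldE(1)[OF F]] .
  have "\<one> [^]\<^bsub>add_monoid R\<lparr>carrier := F\<rparr>\<^esub> order (add_monoid R\<lparr>carrier := F\<rparr>)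
      = \<one>\<^bsub>add_monoid R\<lparr>carrier := F\<rparr>\<^esub>"
    using one by (intro group.pow_order_eq_1 group.subgroup_imp_group add.group_axioms sub) auto
  then have zero: "[(p ^ e)] \<cdot> \<one> = \<zero>"
    using card by (simp add: order_def nat_pow_def add_pow_def)
  have "[(p ^ n)] \<cdot> \<one> = ([p] \<cdot> \<one>) [^] n" for n :: nat
  proof (induction n)
    case (Suc n)
    have "[(p ^ Suc n)] \<cdot> \<one> = [(p ^ n)] \<cdot> ([p] \<cdot> \<one>)"
      by (simp add: add.nat_pow_pow)
    also have "\<dots> = ([(p ^ n)] \<cdot> \<one>) \<otimes> ([p] \<cdot> \<one>)"
      by (simp add: add_pow_ldistr)
    finally show ?case by (simp add: Suc.IH)
  qed (simp add: add.nat_pow_eone)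
  with zero have "([p] \<cdot> \<one>) [^] e = \<zero>" by simp
  then show ?thesis
    by (induction e) (auto simp: integral_iff)
qed

text \<open>
  The \<open>card F - 1\<close> nonzero elements of \<open>F\<close> are already roots of \<open>X ^ (card F - 1) = 1\<close>, so
  there is no room for a root outside \<open>F\<close>. The roots are counted inside the finite field \<open>K\<close>.
\<close>

lemma (in field) mem_finite_subfield_if_pow_card:
  assumes F: "subfield F R" and K: "subfield K R" and fin: "finite K" and FK: "F \<subseteq> K"
    and x: "x \<in> K" and fixed: "x [^] card F = x"
  shows "x \<in> F"
proof (cases "x = \<zero>")
  case True
  then show ?thesis using subringE(2)[OF subfieldE(1)[OF F]] by simp
next
  case False
  have finF: "finite F" using fin FK finite_subset by blast
  have F01: "\<zero> \<in> F" "\<one> \<in> F" "\<one> \<noteq> \<zero>" and KR: "K \<subseteq> carrier R"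
    using subringE[OF subfieldE(1)[OF F]] subfieldE(3)[OF K] by auto
  define d where "d = card (F - {\<zero>})"
  have card: "card F = Suc d"
    using F01 finF unfolding d_def by (metis card_Suc_Diff1)
  have d: "d \<noteq> 0" using F01 finF unfolding d_def by (subst card_0_eq) auto
  define U where "U = {y \<in> K. y [^] d = \<one>}"
  have unity: "y \<in> U" if "y \<in> K" "y \<noteq> \<zero>" "y [^] card F = y" for y
  proof -
    have "y [^] d \<otimes> y = \<one> \<otimes> y" using that KR card by auto
    then show ?thesis using that KR m_rcancel[of y "y [^] d" \<one>] by (auto simp: U_def)
  qed
  interpret K: field "R\<lparr>carrier := K\<rparr>" using subfield_iff(2)[OF K] .
  have "card U \<le> d"
    using K.num_roots_le_deg[of d] fin d by (simp add: U_def nat_pow_def)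
  moreover have "F - {\<zero>} \<subseteq> U"
    using unity finite_subfield_pow_card[OF F finF] FK by blast
  moreover have "finite U" using fin by (simp add: U_def)
  ultimately have "F - {\<zero>} = U"
    unfolding d_def by (intro card_seteq)
  then show ?thesis using unity[OF x False fixed] by blast
qed

lemma (in monoid) pow_power_fixed:
  assumes x: "x \<in> carrier G" and fixed: "x [^] (a ^ s) = x"
  shows "x [^] (a ^ (s * n) :: nat) = x"
proof (induction n)
  case (Suc n)
  have "x [^] (a ^ (s * Suc n)) = (x [^] (a ^ s)) [^] (a ^ (s * n))"
    using x by (simp add: nat_pow_pow power_add)
  then show ?case using fixed Suc by simp
qed (use x in simp)

text \<open>
  If the \<open>m\<close>-th and the \<open>r\<close>-th iterate of \<open>x \<mapsto> x [^] a\<close> both fix \<open>x\<close>, then so does the first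
  iterate: by Bezout some multiple of \<open>r\<close> exceeds a multiple of \<open>m\<close> by exactly one.
\<close>

lemma (in monoid) pow_power_fixed_coprime:
  assumes x: "x \<in> carrier G" and cop: "coprime m r" and r: "r \<noteq> 0"
    and fixed: "x [^] (a ^ m :: nat) = x" "x [^] (a ^ r) = x"
  shows "x [^] a = x"
proof -
  obtain u v where uv: "r * u = m * v + 1"
    using bezout_nat[of r m] r cop by (auto simp: coprime_iff_gcd_eq_1 gcd.commute)
  have "x = x [^] (a ^ (r * u))" using pow_power_fixed[OF x fixed(2)] by simp
  also have "\<dots> = (x [^] (a ^ (m * v))) [^] a"
    using x by (simp add: uv nat_pow_pow mult.commute)
  also have "\<dots> = x [^] a" using pow_power_fixed[OF x fixed(1)] by simp
  finally show ?thesis by simp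
qed

section \<open>Linear relations and their conjugates\<close>

lemma (in ring) combine_map_eq_finsum:
  assumes "distinct ks" and "\<And>k. k \<in> set ks \<Longrightarrow> a k \<in> carrier R"
    and "\<And>k. k \<in> set ks \<Longrightarrow> u k \<in> carrier R"
  shows "combine (map a ks) (map u ks) = (\<Oplus>k\<in>set ks. a k \<otimes> u k)"
  using assms by (induction ks) (auto simp: Pi_def)

lemma (in ring) independent_finsum_eq_zero:
  assumes F: "subfield F R" and ind: "independent F (map u ks)" and ks: "distinct ks"
    and a: "\<And>k. k \<in> set ks \<Longrightarrow> a k \<in> F" and zero: "(\<Oplus>k\<in>set ks. a k \<otimes> u k) = \<zero>"
    and k: "k \<in> set ks"
  shows "a k = \<zero>"
proof -
  have "combine (map a ks) (map u ks) = \<zero>"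
    using independent_in_carrier[OF ind] subfieldE(3)[OF F] a zero
    by (subst combine_map_eq_finsum[OF ks]) auto
  then have "set (take (length (map u ks)) (map a ks)) \<subseteq> {\<zero>}"
    using a by (intro independent_imp_trivial_combine[OF F ind]) auto
  then show ?thesis using k by auto
qed

text \<open>
  This is the support bound explained at the start, for an arbitrary ring endomorphism \<open>h\<close>
  that maps some subset of \<open>K\<close> onto \<open>K\<close> and whose fixed points in \<open>K\<close> lie in \<open>F\<close>. Allowing
  the number \<open>n\<close> of relations to differ from the length of the vector is what makes the
  induction possible: passing from \<open>b\<close> to a sparser vector loses one relation and one
  nonzero entry at the same time.
\<close>

lemma (in field) endomorphism_relations_imp_zero:
  assumes hom: "h \<in> ring_hom R R" and K: "subfield K R"
    and preimage: "\<And>x. x \<in> K \<Longrightarrow> \<exists>y\<in>K. h y = x"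
    and fixed: "\<And>x. x \<in> K \<Longrightarrow> h x = x \<Longrightarrow> x \<in> F"
    and I: "finite I" and u: "\<And>k. k \<in> I \<Longrightarrow> u k \<in> carrier R"
    and ind: "\<And>a. (\<And>k. k \<in> I \<Longrightarrow> a k \<in> F) \<Longrightarrow> (\<Oplus>k\<in>I. a k \<otimes> u k) = \<zero> \<Longrightarrow>
      \<forall>k\<in>I. a k = \<zero>"
    and b: "\<And>k. k \<in> I \<Longrightarrow> b k \<in> K"
    and rel: "\<And>i. i < n \<Longrightarrow> (\<Oplus>k\<in>I. b k \<otimes> (h ^^ i) (u k)) = \<zero>"
    and supp: "card {k \<in> I. b k \<noteq> \<zero>} \<le> n"
  shows "\<forall>k\<in>I. b k = \<zero>"
  using b rel supp
proof (induction n arbitrary: b)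
  case 0
  then show ?case using I by simp
next
  case (Suc n)
  interpret hom: ring_hom_cring R R h
    using hom by unfold_locales
  have KR: "x \<in> carrier R" if "x \<in> K" for x using that subfieldE(3)[OF K] by auto
  have h_zero: "x = \<zero>" if x: "x \<in> carrier R" "h x = \<zero>" for x
  proof (rule ccontr)
    assume "x \<noteq> \<zero>"
    then have "x \<in> Units R" using x field_Units by simp
    then have "h x \<otimes> h (inv x) = \<one>"
      using hom.hom_mult[of x "inv x"] x by simp
    then show False using x \<open>x \<in> Units R\<close> by simp
  qed
  have iter: "(h ^^ i) (u k) \<in> carrier R" if "k \<in> I" for i k
    using that u by (induction i) auto
  show ?case
  proof (rule ccontr)
    assume "\<not> ?case"
    then obtain j where j: "j \<in> I" "b j \<noteq> \<zero>" by blast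
    \<comment> \<open>scaling by \<open>v\<close> makes entry \<open>j\<close> equal to \<open>1\<close>, which \<open>h\<close> fixes\<close>
    define v where "v = inv (b j)"
    have v: "v \<in> K" "v \<noteq> \<zero>" "v \<otimes> b j = \<one>"
      using subfield_m_inv[OF K, of "b j"] Suc.prems(1) j by (auto simp: v_def)
    define a where "a k = v \<otimes> b k" for k
    have a: "a k \<in> K" if "k \<in> I" for k
      using that v Suc.prems(1) subringE(6)[OF subfieldE(1)[OF K]] by (auto simp: a_def)
    have a_zero: "a k = \<zero> \<longleftrightarrow> b k = \<zero>" if "k \<in> I" for k
      using that v Suc.prems(1) KR by (auto simp: a_def integral_iff)
    have a_rel: "(\<Oplus>k\<in>I. a k \<otimes> (h ^^ i) (u k)) = \<zero>" if "i < Suc n" for i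
    proof -
      have "(\<Oplus>k\<in>I. a k \<otimes> (h ^^ i) (u k)) = (\<Oplus>k\<in>I. v \<otimes> (b k \<otimes> (h ^^ i) (u k)))"
        using v Suc.prems(1) KR iter by (intro finsum_cong') (auto simp: a_def m_assoc)
      also have "\<dots> = v \<otimes> (\<Oplus>k\<in>I. b k \<otimes> (h ^^ i) (u k))"
        using v Suc.prems(1) KR iter I by (intro finsum_rdistr[symmetric]) auto
      finally show ?thesis using Suc.prems(2)[OF that] v KR by simp
    qed
    \<comment> \<open>the entrywise preimage of \<open>a\<close>: applying \<open>h\<close> to relation \<open>i\<close> of \<open>c\<close> gives relation
       \<open>i + 1\<close> of \<open>a\<close>\<close>
    obtain c where c: "\<And>k. k \<in> I \<Longrightarrow> c k \<in> K" "\<And>k. k \<in> I \<Longrightarrow> h (c k) = a k"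
      using bchoice[of I "\<lambda>k y. y \<in> K \<and> h y = a k"] preimage a by blast
    have c_rel: "(\<Oplus>k\<in>I. c k \<otimes> (h ^^ i) (u k)) = \<zero>" if "i < n" for i
    proof (rule h_zero)
      show "(\<Oplus>k\<in>I. c k \<otimes> (h ^^ i) (u k)) \<in> carrier R"
        using c KR iter by (intro finsum_closed) auto
      have "h (\<Oplus>k\<in>I. c k \<otimes> (h ^^ i) (u k)) = (\<Oplus>k\<in>I. a k \<otimes> (h ^^ Suc i) (u k))"
        using c a KR iter by (subst hom.hom_finsum) (auto intro!: finsum_cong')
      then show "h (\<Oplus>k\<in>I. c k \<otimes> (h ^^ i) (u k)) = \<zero>"
        using a_rel[of "Suc i"] that by simp
    qed
    \<comment> \<open>\<open>c\<close> and \<open>a\<close> vanish outside the support of \<open>b\<close> and agree at \<open>j\<close>, so their difference is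
       covered by the induction hypothesis\<close>
    have "\<forall>k\<in>I. c k \<ominus> a k = \<zero>"
    proof (rule Suc.IH)
      show "c k \<ominus> a k \<in> K" if "k \<in> I" for k
        using that a c subringE[OF subfieldE(1)[OF K]] by (simp add: a_minus_def)
      show "(\<Oplus>k\<in>I. (c k \<ominus> a k) \<otimes> (h ^^ i) (u k)) = \<zero>" if i: "i < n" for i
      proof -
        have "(\<Oplus>k\<in>I. a k \<otimes> (h ^^ i) (u k)) \<oplus> (\<Oplus>k\<in>I. (c k \<ominus> a k) \<otimes> (h ^^ i) (u k))
            = (\<Oplus>k\<in>I. a k \<otimes> (h ^^ i) (u k) \<oplus> (c k \<ominus> a k) \<otimes> (h ^^ i) (u k))"
          using a c KR iter by (intro finsum_addf[symmetric]) auto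
        also have "\<dots> = (\<Oplus>k\<in>I. c k \<otimes> (h ^^ i) (u k))"
        proof (intro finsum_cong')
          fix k assume k: "k \<in> I"
          have "a k \<in> carrier R" "c k \<in> carrier R" "(h ^^ i) (u k) \<in> carrier R"
            using k a c KR iter by auto
          then show "a k \<otimes> (h ^^ i) (u k) \<oplus> (c k \<ominus> a k) \<otimes> (h ^^ i) (u k)
              = c k \<otimes> (h ^^ i) (u k)"
            by algebra
        qed (use a c KR iter in auto)
        finally have "\<zero> \<oplus> (\<Oplus>k\<in>I. (c k \<ominus> a k) \<otimes> (h ^^ i) (u k)) = \<zero>"
          using a_rel[of i] c_rel[of i] i by simp
        then show ?thesis using a c KR iter by (simp add: Pi_def)
      qed
      show "card {k \<in> I. c k \<ominus> a k \<noteq> \<zero>} \<le> n"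
      proof -
        have "a j = \<one>" using v by (simp add: a_def)
        have inj: "x = y" if "x \<in> carrier R" "y \<in> carrier R" "h x = h y" for x y
          using h_zero[of "x \<ominus> y"] that hom.hom_sub[of x y] by simp
        have cj: "c j = a j"
          using inj[of "c j" \<one>] c j KR \<open>a j = \<one>\<close> by simp
        have c0: "c k = \<zero>" if "k \<in> I" "b k = \<zero>" for k
          using h_zero[of "c k"] c that a_zero KR by simp
        have "{k \<in> I. c k \<ominus> a k \<noteq> \<zero>} \<subseteq> {k \<in> I. b k \<noteq> \<zero>} - {j}"
          using cj c0 a_zero KR a j by (auto simp: a_minus_def r_neg)
        then have "card {k \<in> I. c k \<ominus> a k \<noteq> \<zero>} \<le> card ({k \<in> I. b k \<noteq> \<zero>} - {j})"
          using I by (intro card_mono) auto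
        also have "\<dots> \<le> n" using I j Suc.prems(3) by simp
        finally show ?thesis .
      qed
    qed
    then have "c k = a k" if "k \<in> I" for k
      using that a c KR by simp
    then have "a k \<in> F" if "k \<in> I" for k
      using that fixed[of "a k"] a c by simp
    moreover have "(\<Oplus>k\<in>I. a k \<otimes> u k) = \<zero>" using a_rel[of 0] by simp
    ultimately have "a j = \<zero>" using ind[of a] j by blast
    then show False using a_zero j by simp
  qed
qed

section \<open>Vanishing of the coefficients\<close>

theorem theorem5p4:
  fixes L :: "('a, 'c) ring_scheme" (structure)
    and F K :: "'a set"
    and q m r w :: nat
    and \<gamma> b :: "nat \<Rightarrow> 'a"
  assumes "primepow q"
    and "m \<ge> 1" and "r \<ge> 1" and "w \<ge> 1"
    and "gcd m r = 1"
    and "algebraic_closure L F" and "card F = q"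
    and "subfield K L" and "F \<subseteq> K" and "card K = q ^ m"
    and "\<And>k. k \<in> {1..w} \<Longrightarrow> \<gamma> k \<in> carrier L"
    and "ring.independent L F (map \<gamma> [1..<Suc w])"
    and "\<And>k. k \<in> {1..w} \<Longrightarrow> b k \<in> K"
    and "\<And>i. i \<le> w - 1 \<Longrightarrow>
           (\<Oplus>k\<in>{1..w}. b k \<otimes> \<gamma> k [^] (q ^ (r * i))) = \<zero>"
  shows "\<forall>k\<in>{1..w}. b k = \<zero>"
proof -
  interpret algebraic_closure L F by fact
  have F: "subfield F L" by (rule subfield_axioms)
  obtain p e where p: "prime p" and q: "q = p ^ e"
    using \<open>primepow q\<close> by (auto simp: primepow_def)
  have char: "[p] \<cdot> \<one> = \<zero>"
    using finite_subfield_char[OF F p] \<open>card F = q\<close> q by simp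
  have finK: "finite K"
    using \<open>card K = q ^ m\<close> p q by (intro card_ge_0_finite) (simp add: prime_gt_0_nat)
  have KL: "K \<subseteq> carrier L" using \<open>subfield K L\<close> by (rule subfieldE(3))
  define h where "h = (\<lambda>x. x [^] (q ^ r))"
  have hom: "h \<in> ring_hom L L"
    using frobenius_ring_hom[OF p char, of "e * r"] by (simp add: h_def q power_mult)
  have K_fixed: "x [^] (q ^ m) = x" if "x \<in> K" for x
    using finite_subfield_pow_card[OF \<open>subfield K L\<close> finK that] \<open>card K = q ^ m\<close> by simp
  have iter: "(h ^^ i) x = x [^] (q ^ (r * i))" if "x \<in> carrier L" for i x
    using that by (induction i) (simp_all add: h_def nat_pow_pow power_add mult.commute)
  have K_pow: "x [^] (n::nat) \<in> K" if "x \<in> K" for x n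
    using that subringE[OF subfieldE(1)[OF \<open>subfield K L\<close>]] by (induction n) auto
  show ?thesis
  proof (rule endomorphism_relations_imp_zero[OF hom \<open>subfield K L\<close>, where F = F and n = w])
    fix x assume x: "x \<in> K"
    \<comment> \<open>\<open>h\<^sup>m\<close> is the identity on \<open>K\<close>, hence \<open>h\<close> has the inverse \<open>h\<^sup>m\<^sup>-\<^sup>1\<close> there\<close>
    have "h (x [^] (q ^ (r * (m - 1)))) = x [^] (q ^ (m * r))"
      using x KL \<open>m \<ge> 1\<close>
      by (cases m) (auto simp: h_def nat_pow_pow power_add[symmetric] mult.commute algebra_simps)
    also have "\<dots> = x" using x KL K_fixed by (auto intro: pow_power_fixed)
    finally show "\<exists>y\<in>K. h y = x" using K_pow[OF x] by blast
  next
    fix x assume x: "x \<in> K" "h x = x"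
    have "x [^] q = x"
    proof (rule pow_power_fixed_coprime)
      show "coprime m r" using \<open>gcd m r = 1\<close> by (simp only: coprime_iff_gcd_eq_1)
      show "x [^] (q ^ r) = x" using x by (simp add: h_def)
    qed (use x KL K_fixed \<open>r \<ge> 1\<close> in auto)
    then show "x \<in> F"
      using mem_finite_subfield_if_pow_card[OF F \<open>subfield K L\<close> finK \<open>F \<subseteq> K\<close>] x \<open>card F = q\<close> by simp
  next
    fix a assume "\<And>k. k \<in> {1..w} \<Longrightarrow> a k \<in> F" "(\<Oplus>k\<in>{1..w}. a k \<otimes> \<gamma> k) = \<zero>"
    moreover have "set [1..<Suc w] = {1..w}" by auto
    ultimately show "\<forall>k\<in>{1..w}. a k = \<zero>"
      using independent_finsum_eq_zero[OF F assms(12), of a] by (metis distinct_upt)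
  next
    fix i assume "i < w"
    have "(\<Oplus>k\<in>{1..w}. b k \<otimes> (h ^^ i) (\<gamma> k)) = (\<Oplus>k\<in>{1..w}. b k \<otimes> \<gamma> k [^] (q ^ (r * i)))"
      using assms(11) subsetD[OF KL assms(13)] by (intro finsum_cong') (auto simp: iter)
    then show "(\<Oplus>k\<in>{1..w}. b k \<otimes> (h ^^ i) (\<gamma> k)) = \<zero>"
      using assms(14)[of i] \<open>i < w\<close> by simp
  next
    show "card {k \<in> {1..w}. b k \<noteq> \<zero>} \<le> w"
      using card_mono[of "{1..w}" "{k \<in> {1..w}. b k \<noteq> \<zero>}"] by (auto simp: subset_iff)
  qed (use assms in auto)
qed

end
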